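(* Let $d=3$. Let two pipelines carry the same source-level model along different admissible paths to a common endpoint medium $(\boldsymbol v,C)$ (admissible), with relative holonomy $D=\rho\begin{pmatrix}1&0\\0&R\end{pmatrix}$, $\rho>0$, $R\in SO(3)$, in the reduced frame. Let $S=c\,A^{-1/2}$ with $A=C-\boldsymbol v\boldsymbol v^{\mathrm T}$, and for unit vectors $\boldsymbol n$ let $$\mathfrak r(\boldsymbol n)=\frac{S^{-1}R^{\mathrm T}S\boldsymbol n}{|S^{-1}R^{\mathrm T}S\boldsymbol n|}.$$ Then the far-field predictions (directivities) of the two pipelines in the endpoint medium satisfy, exactly, $$I_2(\boldsymbol n,\omega)=\frac{|S\,\mathfrak r(\boldsymbol n)|^2}{|S\boldsymbol n|^2}\;I_1\bigl(\mathfrak r(\boldsymbol n),\ \rho\,\omega\bigr).$$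
   Context: Fix $c>0$. A pair $(\boldsymbol v,C)$, $\boldsymbol v\in\mathbb R^3$, $C$ symmetric, is admissible if $A=C-\boldsymbol v\boldsymbol v^{\mathrm T}\succ0$. Its operator is $(\partial_t+\boldsymbol v\cdot\nabla)^2-\nabla\cdot C\nabla$. The canonical map $w_3(\boldsymbol v,C)=\begin{pmatrix}p&\boldsymbol q^{\mathrm T}\\0&S\end{pmatrix}$ with $S=cA^{-1/2}$, $p=(1+\boldsymbol v^{\mathrm T}A^{-1}\boldsymbol v)^{-1/2}$, $\boldsymbol q=pA^{-1}\boldsymbol v$ is the linear change of space--time coordinates carrying this operator to $\Box=\partial_t^2-c^2\Delta$ (the "reduced frame"). In the reduced frame pipeline $i$ has a stationary random source $s'_i$ with wavenumber--frequency spectrum $\Phi'_i(\omega',\boldsymbol k')=\int\langle s'_i(\xi)s'_i(\xi+\zeta)\rangle e^{-\mathrm i(\boldsymbol k'\cdot\boldsymbol x-\omega't)}d\zeta$, $\zeta=(t,\boldsymbol x)$. Relative holonomy $D$ means $s'_2=\rho^{-2}s'_1\circ D^{-1}$. The directivity $I_i(\boldsymbol n,\omega)=\lim_{r\to\infty}r^2S_{pp}(r\boldsymbol n,\omega)$ ($S_{pp}$ the far-field pressure spectral density in the endpoint medium) is given by far-field sampling along group rays: $$I_i(\boldsymbol n,\omega)=K(\boldsymbol n)\,\Phi'_i\Bigl(\frac{\omega}{p},\ \frac{\omega}{pc}\frac{S\boldsymbol n}{|S\boldsymbol n|}\Bigr),\qquad K(\boldsymbol n)=K_0|S\boldsymbol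 n|^{-2},$$ with $K_0>0$ a constant common to both pipelines. *)

theory Defs
  imports "HOL-Probability.Probability"
begin

text \<open>Space--time points are pairs \<open>(t, x)\<close>, in the order used for
  \<open>\<zeta> = (t, x)\<close>, and a medium is a pair \<open>(v, C)\<close>.\<close>

type_synonym spacetime = "real \<times> (real^3)"
type_synonym medium = "(real^3) \<times> (real^3^3)"

definition positive_definite :: "real^'n^'n \<Rightarrow> bool" where
  "positive_definite A \<longleftrightarrow> transpose A = A \<and> (\<forall>x. x \<noteq> 0 \<longrightarrow> 0 < x \<bullet> (A *v x))"

text \<open>\<open>A\<close> to the power \<open>-1/2\<close>: the unique symmetric positive definite square root of
  the inverse. Only meaningful for positive definite \<open>A\<close>.\<close>

definition inverse_sqrt :: "real^'n^'n \<Rightarrow> real^'n^'n" where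
  "inverse_sqrt A = (THE B. positive_definite B \<and> B ** B = matrix_inv A)"

definition reduced_matrix :: "real^3 \<Rightarrow> real^3^3 \<Rightarrow> real^3^3" where
  "reduced_matrix v C = C - (\<chi> i j. v $ i * v $ j)"

definition admissible :: "medium \<Rightarrow> bool" where
  "admissible = (\<lambda>(v, C). transpose C = C \<and> positive_definite (reduced_matrix v C))"

text \<open>The diagonal blocks of the canonical map
  \<open>(t, x) \<mapsto> (p t + q \<bullet> x, S x)\<close> to the reduced frame, where \<open>q = p A\<inverse> v\<close>.\<close>

definition canonical_p :: "real^3 \<Rightarrow> real^3^3 \<Rightarrow> real" where
  "canonical_p v C = 1 / sqrt (1 + v \<bullet> (matrix_inv (reduced_matrix v C) *v v))"

definition canonical_S :: "real \<Rightarrow> real^3 \<Rightarrow> real^3^3 \<Rightarrow> real^3^3" where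
  "canonical_S c v C = c *\<^sub>R inverse_sqrt (reduced_matrix v C)"

text \<open>A random source is a real random field on space--time over the probability space
  \<open>M\<close>. By stationarity the base point of the correlation is immaterial; the origin is used.\<close>

definition wide_sense_stationary :: "'w measure \<Rightarrow> ('w \<Rightarrow> spacetime \<Rightarrow> real) \<Rightarrow> bool" where
  "wide_sense_stationary M s \<longleftrightarrow>
     (\<forall>\<xi>. (\<lambda>w. s w \<xi>) \<in> borel_measurable M \<and> integrable M (\<lambda>w. (s w \<xi>)\<^sup>2)) \<and>
     (\<forall>\<xi> \<eta>. (LINT w|M. s w \<xi>) = (LINT w|M. s w \<eta>)) \<and>
     (\<forall>\<xi> \<eta> \<zeta>. (LINT w|M. s w \<xi> * s w (\<xi> + \<zeta>)) = (LINT w|M. s w \<eta> * s w (\<eta> + \<zeta>)))"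

definition autocorrelation :: "'w measure \<Rightarrow> ('w \<Rightarrow> spacetime \<Rightarrow> real) \<Rightarrow> spacetime \<Rightarrow> real" where
  "autocorrelation M s \<zeta> = (LINT w|M. s w 0 * s w (0 + \<zeta>))"

definition spectrum :: "'w measure \<Rightarrow> ('w \<Rightarrow> spacetime \<Rightarrow> real) \<Rightarrow> real \<Rightarrow> real^3 \<Rightarrow> complex" where
  "spectrum M s \<omega> k =
     (LINT \<zeta>|lborel. complex_of_real (autocorrelation M s \<zeta>) *
        exp (- (\<i> * complex_of_real (k \<bullet> snd \<zeta> - \<omega> * fst \<zeta>))))"

definition stationary_source :: "'w measure \<Rightarrow> ('w \<Rightarrow> spacetime \<Rightarrow> real) \<Rightarrow> bool" where
  "stationary_source M s \<longleftrightarrow>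
     wide_sense_stationary M s \<and> integrable lborel (autocorrelation M s)"

text \<open>The linear map with block matrix \<open>\<rho> diag(1, R)\<close> on space--time.\<close>

definition scaled_rotation :: "real \<Rightarrow> real^3^3 \<Rightarrow> spacetime \<Rightarrow> spacetime" where
  "scaled_rotation \<rho> R = (\<lambda>(t, x). (\<rho> * t, \<rho> *\<^sub>R (R *v x)))"

definition relative_holonomy ::
    "'w measure \<Rightarrow> real \<Rightarrow> (spacetime \<Rightarrow> spacetime) \<Rightarrow>
     ('w \<Rightarrow> spacetime \<Rightarrow> real) \<Rightarrow> ('w \<Rightarrow> spacetime \<Rightarrow> real) \<Rightarrow> bool" where
  "relative_holonomy M \<rho> D s1 s2 \<longleftrightarrow>
     (\<forall>w\<in>space M. \<forall>\<xi>. s2 w \<xi> = (1 / \<rho>\<^sup>2) * s1 w (inv D \<xi>))"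

text \<open>A pipeline: the path of media it follows, its random source in the reduced frame, and the
  pressure spectral density \<open>S\<^sub>p\<^sub>p(x, \<omega>)\<close> it predicts in the endpoint medium.\<close>

record 'w pipeline =
  medium_path :: "real \<Rightarrow> medium"
  source :: "'w \<Rightarrow> spacetime \<Rightarrow> real"
  pressure_psd :: "real^3 \<Rightarrow> real \<Rightarrow> real"

definition admissible_path_to :: "medium \<Rightarrow> (real \<Rightarrow> medium) \<Rightarrow> bool" where
  "admissible_path_to m \<gamma> \<longleftrightarrow>
     path \<gamma> \<and> path_image \<gamma> \<subseteq> Collect admissible \<and> pathfinish \<gamma> = m"

definition directivity :: "'w pipeline \<Rightarrow> real^3 \<Rightarrow> real \<Rightarrow> real" where
  "directivity P n \<omega> = Lim at_top (\<lambda>r. r\<^sup>2 * pressure_psd P (r *\<^sub>R n) \<omega>)"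

text \<open>The far-field sampling law along group rays, with \<open>K(n) = K\<^sub>0 / |S n|\<^sup>2\<close>. It asserts that
  the limit defining the directivity exists and gives its value. The spectrum of a real stationary
  source is real, so the equation between complex numbers is one between reals.\<close>

definition far_field_sampling ::
    "'w measure \<Rightarrow> real \<Rightarrow> real \<Rightarrow> real^3 \<Rightarrow> real^3^3 \<Rightarrow> 'w pipeline \<Rightarrow> bool" where
  "far_field_sampling M c K0 v C P \<longleftrightarrow>
     (let S = canonical_S c v C; p = canonical_p v C in
      \<forall>n \<omega>. norm n = 1 \<longrightarrow>
        ((\<lambda>r. complex_of_real (r\<^sup>2 * pressure_psd P (r *\<^sub>R n) \<omega>)) \<longlongrightarrow>
           complex_of_real (K0 / (norm (S *v n))\<^sup>2) *
           spectrum M (source P) (\<omega> / p)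
             ((\<omega> / (p * c)) *\<^sub>R ((1 / norm (S *v n)) *\<^sub>R (S *v n)))) at_top)"

end

theory Submission
  imports Defs
begin

text \<open>By the change of variables \<open>\<zeta> = D \<eta>\<close> the holonomy turns the spectrum of the first source into
  \<open>\<Phi>\<^sub>2 (\<omega>, k) = \<Phi>\<^sub>1 (\<rho> \<omega>, \<rho> R\<^sup>T k)\<close>. Since \<open>S r(n)\<close> is a positive multiple of \<open>R\<^sup>T S n\<close>, the
  direction at which the second pipeline samples its spectrum in direction \<open>n\<close> is carried to the one
  at which the first pipeline samples in direction \<open>r(n)\<close>; only the prefactors \<open>K\<close> differ. That \<open>S\<close> is
  invertible rests on the spectral theorem, which provides the positive definite square root.\<close>

section \<open>Spectral theorem for self-adjoint maps\<close>

text \<open>The eigenvector is a maximiser \<open>x\<close> of the quadratic form on the unit sphere of \<open>W\<close>: the form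
  \<open>g y = l (y \<bullet> y) - y \<bullet> f y\<close> is nonnegative on \<open>W\<close> and vanishes at \<open>x\<close>, so its gradient there,
  a multiple of \<open>l x - f x\<close>, must be zero.\<close>

lemma selfadjoint_eigenvector_exists:
  fixes f :: "'a::euclidean_space \<Rightarrow> 'a"
  assumes f: "linear f" and sym: "\<And>x y. x \<bullet> f y = f x \<bullet> y"
    and W: "subspace W" and inv: "\<And>x. x \<in> W \<Longrightarrow> f x \<in> W" and "a \<in> W" "a \<noteq> 0"
  obtains x l where "x \<in> W" "norm x = 1" "f x = l *\<^sub>R x"
proof -
  let ?K = "W \<inter> sphere 0 1"
  have "compact ?K"
    by (simp add: closed_Int_compact W closed_subspace)
  moreover have "?K \<noteq> {}"
  proof -
    have "a /\<^sub>R norm a \<in> ?K"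
      using assms by (simp add: subspace_scale)
    then show ?thesis by blast
  qed
  moreover have "continuous_on ?K (\<lambda>x. x \<bullet> f x)"
    by (intro continuous_intros linear_continuous_on linear_conv_bounded_linear[THEN iffD1] f)
  ultimately obtain x where x: "x \<in> ?K" and max: "\<And>y. y \<in> ?K \<Longrightarrow> y \<bullet> f y \<le> x \<bullet> f x"
    using continuous_attains_sup by metis
  define l where "l = x \<bullet> f x"
  define g where "g y = l * (y \<bullet> y) - y \<bullet> f y" for y
  have nx: "x \<bullet> x = 1"
    using x by (simp add: dot_square_norm)
  have g_nonneg: "0 \<le> g y" if "y \<in> W" for y
  proof (cases "y = 0")
    case True
    then show ?thesis by (simp add: g_def)
  next
    case False
    have "y /\<^sub>R norm y \<in> ?K"
      using that False W by (simp add: subspace_scale)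
    from max[OF this] have "(y \<bullet> f y) / (norm y)\<^sup>2 \<le> l"
      by (simp add: l_def linear_scale[OF f] power2_eq_square divide_inverse mult.commute mult.left_commute)
    then show ?thesis
      using False by (simp add: g_def field_simps flip: power2_norm_eq_inner)
  qed
  define y where "y = l *\<^sub>R x - f x"
  \<comment> \<open>The quadratic \<open>2 * t * (y \<bullet> y) + t\<^sup>2 * g y\<close> has its
    minimum at \<open>- (y \<bullet> y) / g y\<close>. Adding 1 keeps the denominator positive even
    if \<open>g y = 0\<close>, and the value at this \<open>t\<close> is still negative unless
    \<open>y = 0\<close>.\<close>
  define t where "t = - (y \<bullet> y) / (g y + 1)"
  have y: "y \<in> W"
    using x W inv by (simp add: y_def subspace_diff subspace_scale)
  have "g (x + t *\<^sub>R y) = g x + 2 * t * (y \<bullet> y) + t\<^sup>2 * g y"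
  proof -
    have "x \<bullet> f y = f x \<bullet> y" by (rule sym)
    then have "g (x + t *\<^sub>R y) = g x + 2 * t * (l * (x \<bullet> y) - f x \<bullet> y) + t\<^sup>2 * g y"
      by (simp add: g_def linear_add[OF f] linear_scale[OF f] inner_add_left inner_add_right
          inner_commute[of y x] inner_commute[of y "f x"] algebra_simps power2_eq_square)
    also have "l * (x \<bullet> y) - f x \<bullet> y = (l *\<^sub>R x - f x) \<bullet> y"
      by (simp add: inner_diff_left)
    finally show ?thesis
      unfolding y_def[symmetric] .
  qed
  moreover have "g x = 0"
    by (simp add: g_def nx l_def)
  moreover have "0 \<le> g (x + t *\<^sub>R y)"
    using x y W by (intro g_nonneg) (simp add: subspace_add subspace_scale)
  ultimately have "0 \<le> 2 * t * (y \<bullet> y) + t\<^sup>2 * g y" by simp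
  also have "\<dots> = - (y \<bullet> y)\<^sup>2 * (g y + 2) / (g y + 1)\<^sup>2"
  proof -
    have "2 * (- a / d) * a + (- a / d)\<^sup>2 * (d - 1) = - a\<^sup>2 * (d + 1) / d\<^sup>2"
      if "d \<noteq> 0" for a d :: real
      using that by (simp add: field_simps power2_eq_square)
    from this[of "g y + 1" "y \<bullet> y"] show ?thesis
      using g_nonneg[OF y] by (simp add: t_def add.assoc)
  qed
  finally have "(y \<bullet> y)\<^sup>2 * (g y + 2) / (g y + 1)\<^sup>2 \<le> 0" by simp
  moreover have "0 < (g y + 2) / (g y + 1)\<^sup>2"
    using g_nonneg[OF y] by simp
  ultimately have "(y \<bullet> y)\<^sup>2 \<le> 0"
    by (metis mult_le_0_iff not_less times_divide_eq_right)
  then have "f x = l *\<^sub>R x"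
    by (simp add: y_def)
  with that x show ?thesis by auto
qed

text \<open>Orthonormal sets of eigenvectors are independent, so one of maximal size exists. If it
  did not span, its orthogonal complement would be a nonzero invariant subspace and hence contain
  one more eigenvector.\<close>

theorem selfadjoint_orthonormal_eigenbasis:
  fixes f :: "'a::euclidean_space \<Rightarrow> 'a"
  assumes f: "linear f" and sym: "\<And>x y. x \<bullet> f y = f x \<bullet> y"
  obtains E l where "finite E" "pairwise orthogonal E" "\<And>e. e \<in> E \<Longrightarrow> norm e = 1"
    "\<And>e. e \<in> E \<Longrightarrow> f e = l e *\<^sub>R e" "span E = UNIV"
proof -
  define P where "P E \<longleftrightarrow> pairwise orthogonal E \<and> (\<forall>e\<in>E. norm e = 1 \<and> (\<exists>l. f e = l *\<^sub>R e))" for E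
  have indep: "independent E" if "P E" for E
    using that by (intro pairwise_orthogonal_independent) (auto simp: P_def)
  have "P {}" by (simp add: P_def)
  moreover have "\<forall>E. P E \<longrightarrow> card E < Suc (DIM('a))"
    by (simp add: indep independent_card_le less_Suc_eq_le)
  ultimately obtain E where E: "P E" and max: "\<And>F. P F \<Longrightarrow> card F \<le> card E"
    using ex_has_greatest_nat[of P "{}" card "Suc (DIM('a))"] by (metis less_imp_le)
  have fin: "finite E"
    using indep[OF E] by (rule finiteI_independent)
  have "span E = UNIV"
  proof (rule ccontr)
    assume "span E \<noteq> UNIV"
    then have "dim E < DIM('a)"
      using dim_eq_full[of E] dim_subset_UNIV[of E] by linarith
    then have "\<exists>a. a \<noteq> 0 \<and> (\<forall>y\<in>span E. orthogonal a y)"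
      by (rule orthogonal_to_subspace_exists) auto
    then obtain a where a: "a \<noteq> 0" "\<forall>y\<in>span E. orthogonal a y"
      by blast
    define W where "W = {x. \<forall>e\<in>E. orthogonal e x}"
    have "subspace W"
      by (simp add: W_def subspace_def orthogonal_def inner_add_right)
    moreover have "f x \<in> W" if x: "x \<in> W" for x
    proof -
      have "e \<bullet> f x = 0" if "e \<in> E" for e
      proof -
        obtain l where "f e = l *\<^sub>R e"
          using E \<open>e \<in> E\<close> by (auto simp only: P_def)
        moreover have "e \<bullet> x = 0"
          using x that by (simp add: W_def orthogonal_def)
        moreover have "e \<bullet> f x = f e \<bullet> x" by (rule sym)
        ultimately show ?thesis by simp
      qed
      then show ?thesis by (simp add: W_def orthogonal_def)
    qed
    moreover have "a \<in> W"
      using a(2) by (simp add: W_def orthogonal_commute span_base)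
    ultimately obtain x l where x: "x \<in> W" "norm x = 1" "f x = l *\<^sub>R x"
      using a(1) by (rule selfadjoint_eigenvector_exists[OF f sym])
    \<comment> \<open>Otherwise \<open>x\<close> would be orthogonal to itself, against
      \<open>norm x = 1\<close>. Hence \<open>insert x E\<close> is strictly larger than
      \<open>E\<close>.\<close>
    then have "x \<notin> E"
      by (auto simp: W_def orthogonal_def)
    moreover have "P (insert x E)"
      using E x by (simp add: P_def W_def pairwise_insert orthogonal_commute[of x])
    ultimately show False
      using max[of "insert x E"] fin by simp
  qed
  moreover have "\<forall>e\<in>E. \<exists>l. f e = l *\<^sub>R e"
    using E unfolding P_def by blast
  then obtain l where "\<forall>e\<in>E. f e = l e *\<^sub>R e"
    using bchoice[of E "\<lambda>e l. f e = l *\<^sub>R e"] by blast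
  moreover have "pairwise orthogonal E" "\<forall>e\<in>E. norm e = 1"
    using E by (simp_all add: P_def)
  ultimately show ?thesis
    by (intro that[of E l] fin) simp_all
qed

section \<open>Positive definite matrices and their square roots\<close>

lemma positive_definite_inner_commute:
  assumes "positive_definite A"
  shows "x \<bullet> (A *v y) = (A *v x) \<bullet> y"
  using assms dot_lmul_matrix[of x A y] transpose_matrix_vector[of A x]
  by (simp add: positive_definite_def)

lemma positive_definite_invertible:
  fixes A :: "real^'n^'n"
  assumes "positive_definite A"
  shows "invertible A"
proof -
  have "x = 0" if "A *v x = 0" for x
    using assms that unfolding positive_definite_def by (metis inner_zero_right less_irrefl)
  then show ?thesis
    by (simp add: invertible_left_inverse matrix_left_invertible_ker)
qed

lemma invertible_matrix_inv:
  assumes "invertible A"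
  shows "A ** matrix_inv A = mat 1 \<and> matrix_inv A ** A = mat 1"
  using assms unfolding invertible_def matrix_inv_def by (rule someI_ex)

lemma symmetric_if_inner_commute:
  fixes B :: "real^'n^'n"
  assumes "\<And>x y. x \<bullet> (B *v y) = (B *v x) \<bullet> y"
  shows "transpose B = B"
proof -
  have "(transpose B *v x) \<bullet> y = (B *v x) \<bullet> y" for x y
    using assms[of x y] dot_lmul_matrix[of x B y] by (simp add: transpose_matrix_vector)
  then show ?thesis
    by (metis matrix_eq vector_eq_rdot)
qed

text \<open>Substituting \<open>A *v y\<close> for \<open>x\<close>, with
  \<open>y = matrix_inv A *v x\<close>, turns symmetry and positivity of the inverse into those of
  \<open>A\<close>.\<close>

lemma positive_definite_matrix_inv:
  fixes A :: "real^'n^'n"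
  assumes "positive_definite A"
  shows "positive_definite (matrix_inv A)"
proof -
  let ?B = "matrix_inv A"
  have AB: "A *v (?B *v x) = x" for x
    using invertible_matrix_inv[OF positive_definite_invertible[OF assms]]
    by (simp add: matrix_vector_mul_assoc)
  have "x \<bullet> (?B *v y) = (?B *v x) \<bullet> y" for x y
    by (metis AB positive_definite_inner_commute[OF assms])
  then have "transpose ?B = ?B"
    by (rule symmetric_if_inner_commute)
  moreover have "0 < x \<bullet> (?B *v x)" if "x \<noteq> 0" for x
  proof -
    have "?B *v x \<noteq> 0"
      using AB[of x] that by auto
    then have "0 < (?B *v x) \<bullet> (A *v (?B *v x))"
      using assms by (simp add: positive_definite_def)
    then show ?thesis
      by (simp add: AB inner_commute)
  qed
  ultimately show ?thesis
    by (simp add: positive_definite_def)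
qed

text \<open>In an orthonormal eigenbasis of \<open>A\<close> every eigenvalue is positive;
  \<open>h\<close> is the map that replaces each by its square root.\<close>

lemma positive_definite_sqrt_exists:
  fixes A :: "real^'n^'n"
  assumes A: "positive_definite A"
  obtains B where "positive_definite B" "B ** B = A"
proof -
  obtain E l where fin: "finite E" and orth: "pairwise orthogonal E"
    and norm: "\<And>e. e \<in> E \<Longrightarrow> norm e = 1"
    and eig: "\<And>e. e \<in> E \<Longrightarrow> A *v e = l e *\<^sub>R e" and span: "span E = UNIV"
    using selfadjoint_orthonormal_eigenbasis[OF matrix_vector_mul_linear positive_definite_inner_commute[OF A]]
    by blast
  have l: "0 < l e" if "e \<in> E" for e
  proof -
    have "e \<noteq> 0" "e \<bullet> e = 1"
      using norm[OF that] by (auto simp: dot_square_norm)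
    then show ?thesis
      using A eig[OF that] unfolding positive_definite_def by (metis inner_scaleR_right mult.right_neutral)
  qed
  define h where "h x = (\<Sum>e\<in>E. (sqrt (l e) * (e \<bullet> x)) *\<^sub>R e)" for x
  have h: "linear h"
    unfolding h_def
    by (intro linearI)
      (simp_all add: inner_add_right distrib_left scaleR_add_left sum.distrib scaleR_sum_right mult.left_commute)
  define B where "B = matrix h"
  have B: "B *v x = h x" for x
    by (simp add: B_def matrix_works h)
  \<comment> \<open>This expression is symmetric in \<open>x\<close> and \<open>y\<close> and a
    weighted sum of squares for \<open>x = y\<close>, which yields both symmetry and positivity of
    \<open>B\<close>.\<close>
  have inner_h: "x \<bullet> h y = (\<Sum>e\<in>E. sqrt (l e) * ((e \<bullet> x) * (e \<bullet> y)))" for x y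
    by (simp add: h_def inner_sum_right inner_commute mult.commute mult.left_commute)
  have he: "h e = sqrt (l e) *\<^sub>R e" if "e \<in> E" for e
  proof -
    have "h e = (\<Sum>e'\<in>E. if e' = e then sqrt (l e) *\<^sub>R e else 0)"
      unfolding h_def
      using orth norm that
      by (intro sum.cong) (auto simp: pairwise_def orthogonal_def dot_square_norm)
    then show ?thesis
      using fin that by simp
  qed
  have "h (h x) = A *v x" for x
  proof (rule linear_eq_on_span[where B = E and f = "\<lambda>x. h (h x)"])
    show "linear (\<lambda>x. h (h x))"
      using linear_compose[OF h h] by (simp add: o_def)
    show "h (h e) = A *v e" if "e \<in> E" for e
      using l[OF that] by (simp add: he that linear_scale[OF h] eig)
  qed (use span in auto)
  then have "B ** B = A"
    by (simp add: matrix_eq B flip: matrix_vector_mul_assoc)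
  moreover have "positive_definite B"
    unfolding positive_definite_def
  proof (intro conjI allI impI)
    show "transpose B = B"
      by (rule symmetric_if_inner_commute) (simp add: B inner_h inner_commute[of "h _"] mult.commute)
    fix x :: "real^'n"
    assume "x \<noteq> 0"
    \<comment> \<open>A vector orthogonal to all of \<open>E\<close> is orthogonal to its span,
      hence to itself. The \<open>e\<close> found here gives a strictly positive summand.\<close>
    then have "\<exists>e\<in>E. e \<bullet> x \<noteq> 0"
      using orthogonal_to_span[of x E x] span by (auto simp: orthogonal_def inner_commute)
    then show "0 < x \<bullet> (B *v x)"
      unfolding B inner_h using l fin
      by (auto intro!: sum_pos2 simp: zero_less_mult_iff less_imp_le linorder_neq_iff)
  qed
  ultimately show ?thesis
    using that by blast
qed

text \<open>If \<open>X = B - B'\<close>, then \<open>B X + X B' = 0\<close>, so the trace of \<open>X\<^sup>T B X + X B' X\<^sup>T\<close> vanishes; both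
  terms have nonnegative trace, and the first one has positive trace unless \<open>X = 0\<close>.\<close>

lemma positive_definite_sqrt_unique:
  fixes B B' :: "real^'n^'n"
  assumes B: "positive_definite B" and B': "positive_definite B'" and eq: "B ** B = B' ** B'"
  shows "B = B'"
proof -
  define X where "X = B - B'"
  have nonneg: "0 \<le> y \<bullet> (Q *v y)" if "positive_definite Q" for Q and y :: "real^'n"
    using that by (cases "y = 0") (auto simp: positive_definite_def less_imp_le)
  have trace_nonneg: "0 \<le> trace (Q ** (X ** transpose X))"
    and trace_eq_0: "trace (Q ** (X ** transpose X)) = 0 \<Longrightarrow> X = 0"
    if Q: "positive_definite Q" for Q
  proof -
    \<comment> \<open>By cyclicity this is the trace of \<open>transpose X ** (Q ** X)\<close>,
      whose diagonal entries are the values of the form \<open>Q\<close> at the columns of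
      \<open>X\<close>.\<close>
    have *: "trace (Q ** (X ** transpose X)) = (\<Sum>j\<in>UNIV. column j X \<bullet> (Q *v column j X))"
    proof -
      have "trace (Q ** (X ** transpose X)) = trace (transpose X ** (Q ** X))"
        by (metis matrix_mul_assoc trace_mul_sym)
      also have "\<dots> = (\<Sum>j\<in>UNIV. column j X \<bullet> (Q *v column j X))"
        by (simp add: trace_def matrix_matrix_mult_def transpose_def column_def inner_vec_def
            matrix_vector_mult_def)
      finally show ?thesis .
    qed
    show "0 \<le> trace (Q ** (X ** transpose X))"
      unfolding * by (intro sum_nonneg nonneg Q)
    assume "trace (Q ** (X ** transpose X)) = 0"
    then have "column j X \<bullet> (Q *v column j X) = 0" for j
      unfolding * by (subst (asm) sum_nonneg_eq_0_iff) (auto intro: nonneg Q)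
    then have "column j X = 0" for j
      using Q unfolding positive_definite_def by (metis less_irrefl)
    then show "X = 0"
      by (simp add: vec_eq_iff column_def)
  qed
  have X: "transpose X = X"
    using B B' by (simp add: X_def positive_definite_def transpose_def vec_eq_iff)
  \<comment> \<open>The mixed product \<open>B ** B'\<close> occurs with opposite signs, so the two
    lines add up to \<open>B ** B - B' ** B'\<close>, which is zero by \<open>eq\<close>.\<close>
  have "B ** X = B ** B - B ** B'" and "X ** B' = B ** B' - B' ** B'"
    by (simp_all add: X_def vec_eq_iff matrix_matrix_mult_def left_diff_distrib right_diff_distrib sum_subtractf)
  with eq have "B ** X = - (X ** B')" by simp
  then have "trace (B ** (X ** X)) = trace (- (X ** B') ** X)"
    by (simp add: matrix_mul_assoc)
  also have "\<dots> = - trace ((X ** B') ** X)"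
    by (simp add: trace_def matrix_matrix_mult_def sum_negf)
  also have "trace ((X ** B') ** X) = trace (B' ** (X ** X))"
    by (metis matrix_mul_assoc trace_mul_sym)
  finally have "trace (B ** (X ** X)) + trace (B' ** (X ** X)) = 0" by simp
  then have "trace (B ** (X ** transpose X)) = 0"
    using trace_nonneg[OF B] trace_nonneg[OF B'] unfolding X by linarith
  then show ?thesis
    using trace_eq_0[OF B] by (simp add: X_def)
qed

text \<open>Existence and uniqueness of the root of \<open>matrix_inv A\<close> make the definite
  description in \<open>inverse_sqrt\<close> denote that root.\<close>

lemma positive_definite_inverse_sqrt:
  fixes A :: "real^'n^'n"
  assumes "positive_definite A"
  shows "positive_definite (inverse_sqrt A)"
proof -
  have "\<exists>!B. positive_definite B \<and> B ** B = matrix_inv A"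
    by (metis positive_definite_matrix_inv[OF assms] positive_definite_sqrt_exists positive_definite_sqrt_unique)
  from theI'[OF this] show ?thesis
    unfolding inverse_sqrt_def by blast
qed

lemma invertible_canonical_S:
  assumes "0 < c" and "admissible (v, C)"
  shows "invertible (canonical_S c v C)"
proof -
  have "positive_definite (reduced_matrix v C)"
    using assms(2) by (simp add: admissible_def)
  then have "invertible (inverse_sqrt (reduced_matrix v C))"
    by (intro positive_definite_invertible positive_definite_inverse_sqrt)
  then show ?thesis
    using assms(1) unfolding canonical_S_def by (intro scalar_invertible) auto
qed

section \<open>Change of variables on space--time\<close>

lemma lborel_distr_orthogonal_transformation:
  fixes f :: "real^'n::{finite,wellorder} \<Rightarrow> real^'n::{finite,wellorder}"
  assumes f: "orthogonal_transformation f"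
  shows "distr lborel lborel f = lborel"
proof (rule sym, rule lborel_eqI)
  obtain g where g: "orthogonal_transformation g" and fg: "\<And>y. f (g y) = y" and gf: "\<And>x. g (f x) = x"
    using f orthogonal_transformation_inv orthogonal_transformation_bij
    by (metis bij_inv_eq_iff)
  have meas: "f \<in> borel_measurable borel"
    using f by (intro borel_measurable_continuous_onI linear_continuous_on)
      (simp add: orthogonal_transformation_linear linear_conv_bounded_linear[symmetric])
  fix l u :: "real^'n::{finite,wellorder}"
  assume le: "\<And>b. b \<in> Basis \<Longrightarrow> l \<bullet> b \<le> u \<bullet> b"
  have vim: "f -` box l u = g ` box l u"
    using fg gf by (auto simp: image_iff) metis
  have "g ` box l u \<in> lmeasurable"
    by (simp add: g measurable_orthogonal_image)
  then have "emeasure lebesgue (g ` box l u) = ennreal (measure lebesgue (g ` box l u))"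
    by (simp add: emeasure_eq_measure2)
  also have "\<dots> = ennreal (measure lebesgue (box l u))"
    by (simp add: measure_orthogonal_image g)
  finally have "emeasure lebesgue (g ` box l u) = ennreal (measure lborel (box l u))"
    by simp
  \<comment> \<open>The volume was computed for \<open>lebesgue\<close>. It carries over to
    \<open>lborel\<close> because the image is a Borel set, being the preimage of a box under
    \<open>f\<close>.\<close>
  moreover have "g ` box l u \<in> sets borel"
    using measurable_sets[OF meas, of "box l u"] vim by simp
  ultimately have "emeasure lborel (f -` box l u) = ennreal (measure lborel (box l u))"
    by (simp add: vim)
  then show "emeasure (distr lborel lborel f) (box l u) = ennreal (\<Prod>b\<in>Basis. (u - l) \<bullet> b)"
    using meas le by (simp add: emeasure_distr measure_lborel_box)
qed simp

text \<open>Lebesgue measure on space--time is the product of those on time and space, and the map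
  acts on each factor separately.\<close>

lemma lborel_distr_orthogonal_snd:
  fixes f :: "real^'n::{finite,wellorder} \<Rightarrow> real^'n::{finite,wellorder}"
  assumes f: "orthogonal_transformation f"
  shows "distr lborel lborel (\<lambda>(t::real, x). (t, f x)) = lborel"
proof -
  have meas: "f \<in> borel_measurable borel"
    using f by (intro borel_measurable_continuous_onI linear_continuous_on)
      (simp add: orthogonal_transformation_linear linear_conv_bounded_linear[symmetric])
  have "distr lborel lborel (\<lambda>t::real. t) \<Otimes>\<^sub>M distr lborel lborel f =
      distr (lborel \<Otimes>\<^sub>M lborel) (lborel \<Otimes>\<^sub>M lborel) (\<lambda>(t::real, x). (t, f x))"
    using meas
    by (intro pair_measure_distr)
      (simp_all add: lborel_distr_orthogonal_transformation[OF f] sigma_finite_lborel)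
  then show ?thesis
    by (simp add: lborel_distr_orthogonal_transformation[OF f] lborel_prod distr_id2)
qed

text \<open>The case of \<open>lborel_affine_euclidean\<close> in which all coordinates are scaled
  by the same \<open>a\<close>, so that the density is a constant power of
  \<open>\<bar>a\<bar>\<close>.\<close>

lemma lborel_integral_scaleR:
  fixes f :: "'a::euclidean_space \<Rightarrow> 'b::{banach, second_countable_topology}"
  assumes f: "f \<in> borel_measurable borel" and "a \<noteq> 0"
  shows "(LINT x|lborel. f x) = \<bar>a\<bar> ^ DIM('a) *\<^sub>R (LINT x|lborel. f (a *\<^sub>R x))"
proof -
  have "(\<Sum>j\<in>Basis. (a * (x \<bullet> j)) *\<^sub>R j) = a *\<^sub>R x" for x :: 'a
    by (simp add: euclidean_representation flip: scaleR_scaleR scaleR_sum_right)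
  then have "lborel = density (distr lborel borel ((*\<^sub>R) a :: 'a \<Rightarrow> 'a)) (\<lambda>_. \<Prod>j\<in>(Basis::'a set). \<bar>a\<bar>)"
    using lborel_affine_euclidean[of "\<lambda>_. a" "0::'a"] assms by (simp add: prod_ennreal)
  then have "(LINT x|lborel. f x) =
      (LINT x|density (distr lborel borel ((*\<^sub>R) a :: 'a \<Rightarrow> 'a)) (\<lambda>_. \<Prod>j\<in>(Basis::'a set). \<bar>a\<bar>). f x)"
    by metis
  also have "\<dots> = \<bar>a\<bar> ^ DIM('a) *\<^sub>R (LINT x|lborel. f (a *\<^sub>R x))"
    using f by (simp add: integral_density integral_distr)
  finally show ?thesis .
qed

text \<open>The map is a dilation by \<open>a\<close> followed by an orthogonal map of the spatial
  part. Only the dilation has a nontrivial Jacobian; the exponent 4 is the dimension of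
  space--time.\<close>

lemma lborel_integral_scaled_rotation:
  fixes f :: "spacetime \<Rightarrow> 'b::{banach, second_countable_topology}"
  assumes f: "f \<in> borel_measurable borel" and "a \<noteq> 0" and R: "orthogonal_matrix R"
  shows "(LINT \<zeta>|lborel. f (scaled_rotation a R \<zeta>)) = (1 / \<bar>a\<bar> ^ 4) *\<^sub>R (LINT \<zeta>|lborel. f \<zeta>)"
proof -
  let ?U = "\<lambda>(t::real, x). (t, R *v x)"
  have R': "orthogonal_transformation ((*v) R)"
    using R by (simp add: orthogonal_transformation_matrix)
  have "continuous_on UNIV ?U"
    unfolding split_def
    by (intro continuous_intros linear_continuous_on_compose[OF continuous_on_snd] matrix_vector_mul_linear)
  then have U: "?U \<in> borel_measurable borel"
    by (rule borel_measurable_continuous_onI)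
  have "(LINT \<zeta>|lborel. f \<zeta>) = (LINT \<zeta>|distr lborel lborel ?U. f \<zeta>)"
    by (simp add: lborel_distr_orthogonal_snd[OF R'])
  also have "\<dots> = (LINT \<zeta>|lborel. f (?U \<zeta>))"
    using U f by (intro integral_distr) simp_all
  also have "\<dots> = \<bar>a\<bar> ^ DIM(spacetime) *\<^sub>R (LINT \<zeta>|lborel. f (?U (a *\<^sub>R \<zeta>)))"
    using U f \<open>a \<noteq> 0\<close> by (intro lborel_integral_scaleR measurable_compose[OF U]) auto
  also have "(\<lambda>\<zeta>. ?U (a *\<^sub>R \<zeta>)) = scaled_rotation a R"
    by (auto simp: scaled_rotation_def matrix_vector_mult_scaleR)
  finally show ?thesis
    using \<open>a \<noteq> 0\<close> by (simp add: o_def)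
qed

section \<open>Effect of the holonomy on correlation and spectrum\<close>

lemma orthogonal_transformation_transpose:
  fixes R :: "real^'n^'n"
  assumes "orthogonal_matrix R"
  shows "orthogonal_transformation ((*v) (transpose R))"
  using assms by (simp add: orthogonal_transformation_matrix orthogonal_matrix_transpose del: transpose_matrix_vector)

lemma inv_scaled_rotation:
  assumes "a \<noteq> 0" and "orthogonal_matrix R"
  shows "inv (scaled_rotation a R) = scaled_rotation (1 / a) (transpose R)"
  using assms
  by (intro inv_unique_comp)
    (auto simp: fun_eq_iff scaled_rotation_def matrix_vector_mult_scaleR matrix_vector_mul_assoc orthogonal_matrix_def
      simp del: transpose_matrix_vector)

text \<open>Each of the two field values contributes \<open>1 / \<rho>\<^sup>2\<close>, and the
  inverse holonomy, being linear, leaves the base point at the origin.\<close>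

lemma autocorrelation_holonomy:
  assumes "0 < \<rho>" and "orthogonal_matrix R"
    and "relative_holonomy M \<rho> (scaled_rotation \<rho> R) s1 s2"
  shows "autocorrelation M s2 \<zeta> =
    (1 / \<rho> ^ 4) * autocorrelation M s1 (scaled_rotation (1 / \<rho>) (transpose R) \<zeta>)"
proof -
  let ?D = "scaled_rotation (1 / \<rho>) (transpose R)"
  have D0: "?D 0 = 0"
    by (simp add: scaled_rotation_def zero_prod_def)
  have "inv (scaled_rotation \<rho> R) = ?D"
    using assms by (simp add: inv_scaled_rotation)
  with assms(3) have s2: "\<forall>w\<in>space M. \<forall>\<xi>. s2 w \<xi> = (1 / \<rho>\<^sup>2) * s1 w (?D \<xi>)"
    by (simp only: relative_holonomy_def)
  have "s2 w 0 * s2 w (0 + \<zeta>) = (1 / \<rho> ^ 4) * (s1 w 0 * s1 w (0 + ?D \<zeta>))" if "w \<in> space M" for w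
  proof -
    have "s2 w 0 = (1 / \<rho>\<^sup>2) * s1 w 0" "s2 w \<zeta> = (1 / \<rho>\<^sup>2) * s1 w (?D \<zeta>)"
      using s2 that D0 by metis+
    then show ?thesis
      by (simp add: power2_eq_square power4_eq_xxxx)
  qed
  then have "autocorrelation M s2 \<zeta> = (LINT w|M. (1 / \<rho> ^ 4) * (s1 w 0 * s1 w (0 + ?D \<zeta>)))"
    unfolding autocorrelation_def by (rule Bochner_Integration.integral_cong[OF refl])
  then show ?thesis
    by (simp add: autocorrelation_def)
qed

text \<open>The Jacobian \<open>\<rho>\<^sup>4\<close> of the holonomy cancels the factor \<open>\<rho>\<^sup>-\<^sup>4\<close> of the correlation.\<close>

lemma spectrum_holonomy:
  assumes "0 < \<rho>" and R: "orthogonal_matrix R"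
    and "relative_holonomy M \<rho> (scaled_rotation \<rho> R) s1 s2"
    and "stationary_source M s1"
  shows "spectrum M s2 \<omega> k = spectrum M s1 (\<rho> * \<omega>) (\<rho> *\<^sub>R (transpose R *v k))"
proof -
  let ?D = "scaled_rotation (1 / \<rho>) (transpose R)"
  \<comment> \<open>The integrand of the first spectrum at the transformed frequency and wavenumber.
    It is chosen so that \<open>G (?D \<zeta>)\<close> carries the phase of the second spectrum at
    \<open>\<zeta>\<close>.\<close>
  define G where "G \<zeta> = complex_of_real (autocorrelation M s1 \<zeta>) *
    exp (- (\<i> * complex_of_real ((\<rho> *\<^sub>R (transpose R *v k)) \<bullet> snd \<zeta> - \<rho> * \<omega> * fst \<zeta>)))" for \<zeta>
  have "autocorrelation M s1 \<in> borel_measurable borel"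
    using assms(4) by (auto simp: stationary_source_def)
  then have "(\<lambda>\<zeta>. complex_of_real (autocorrelation M s1 \<zeta>)) \<in> borel_measurable borel"
    by measurable
  moreover have "continuous_on UNIV (\<lambda>\<zeta>::spacetime. exp (- (\<i> * complex_of_real
      ((\<rho> *\<^sub>R (transpose R *v k)) \<bullet> snd \<zeta> - \<rho> * \<omega> * fst \<zeta>))))"
    by (intro continuous_intros)
  then have "(\<lambda>\<zeta>::spacetime. exp (- (\<i> * complex_of_real
      ((\<rho> *\<^sub>R (transpose R *v k)) \<bullet> snd \<zeta> - \<rho> * \<omega> * fst \<zeta>)))) \<in> borel_measurable borel"
    by (rule borel_measurable_continuous_onI)
  ultimately have G: "G \<in> borel_measurable borel"
    unfolding G_def by (rule borel_measurable_times)
  \<comment> \<open>The factor \<open>\<rho>\<close> cancels the dilation by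
    \<open>1 / \<rho>\<close> in \<open>?D\<close>, and \<open>transpose R\<close> preserves inner
    products.\<close>
  have phase: "(\<rho> *\<^sub>R (transpose R *v k)) \<bullet> snd (?D \<zeta>) - \<rho> * \<omega> * fst (?D \<zeta>) =
      k \<bullet> snd \<zeta> - \<omega> * fst \<zeta>" for \<zeta>
  proof -
    have "(transpose R *v k) \<bullet> (transpose R *v snd \<zeta>) = k \<bullet> snd \<zeta>"
      using orthogonal_transformation_transpose[OF R] unfolding orthogonal_transformation_def by blast
    then show ?thesis
      using \<open>0 < \<rho>\<close> by (simp add: scaled_rotation_def split_def)
  qed
  have "spectrum M s2 \<omega> k = (LINT \<zeta>|lborel. complex_of_real (1 / \<rho> ^ 4) * G (?D \<zeta>))"
    unfolding spectrum_def G_def phase autocorrelation_holonomy[OF assms(1-3)] of_real_mult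
    by (simp only: mult.assoc)
  also have "\<dots> = complex_of_real (1 / \<rho> ^ 4) * (LINT \<zeta>|lborel. G (?D \<zeta>))"
    by simp
  also have "(LINT \<zeta>|lborel. G (?D \<zeta>)) = \<rho> ^ 4 *\<^sub>R (LINT \<zeta>|lborel. G \<zeta>)"
    using \<open>0 < \<rho>\<close> R by (subst lborel_integral_scaled_rotation[OF G]) (auto simp: power_one_over)
  also have "complex_of_real (1 / \<rho> ^ 4) * (\<rho> ^ 4 *\<^sub>R (LINT \<zeta>|lborel. G \<zeta>)) = (LINT \<zeta>|lborel. G \<zeta>)"
    using \<open>0 < \<rho>\<close> by (simp add: scaleR_conv_of_real)
  finally show ?thesis
    by (simp add: spectrum_def G_def)
qed

section \<open>Comparison of the directivities\<close>

text \<open>The sampling law is a complex limit, whereas \<open>directivity\<close> is a real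
  \<open>Lim\<close>. Taking real parts links the two without a separate proof that the spectrum is
  real.\<close>

lemma directivity_eq_Re_spectrum:
  assumes "far_field_sampling M c K0 v C P" and "norm n = 1"
    and "S = canonical_S c v C" and "p = canonical_p v C"
  shows "directivity P n \<omega> = K0 / (norm (S *v n))\<^sup>2 *
    Re (spectrum M (source P) (\<omega> / p) ((\<omega> / (p * c)) *\<^sub>R ((1 / norm (S *v n)) *\<^sub>R (S *v n))))"
proof -
  let ?\<Phi> = "spectrum M (source P) (\<omega> / p) ((\<omega> / (p * c)) *\<^sub>R ((1 / norm (S *v n)) *\<^sub>R (S *v n)))"
  have "((\<lambda>r. complex_of_real (r\<^sup>2 * pressure_psd P (r *\<^sub>R n) \<omega>)) \<longlongrightarrow>
      complex_of_real (K0 / (norm (S *v n))\<^sup>2) * ?\<Phi>) at_top"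
    using assms unfolding far_field_sampling_def Let_def by blast
  from tendsto_Re[OF this]
  have "((\<lambda>r. r\<^sup>2 * pressure_psd P (r *\<^sub>R n) \<omega>) \<longlongrightarrow> K0 / (norm (S *v n))\<^sup>2 * Re ?\<Phi>) at_top"
    by (simp only: times_complex.sel Re_complex_of_real Im_complex_of_real mult_zero_left diff_zero)
  then show ?thesis
    unfolding directivity_def by (intro tendsto_Lim) simp_all
qed

theorem corollary38:
  fixes M :: "'w measure"
    and c K0 \<rho> :: real
    and v :: "real^3"
    and C R S :: "real^3^3"
    and D :: "spacetime \<Rightarrow> spacetime"
    and P1 P2 :: "'w pipeline"
    and \<rr> :: "real^3 \<Rightarrow> real^3"
  assumes "prob_space M" and "0 < c" and "0 < K0"
    and "admissible (v, C)"
    and "admissible_path_to (v, C) (medium_path P1)"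
    and "admissible_path_to (v, C) (medium_path P2)"
    and "stationary_source M (source P1)"
    and "stationary_source M (source P2)"
    and "far_field_sampling M c K0 v C P1"
    and "far_field_sampling M c K0 v C P2"
    and "0 < \<rho>" and "orthogonal_matrix R" and "det R = 1"
    and "D = scaled_rotation \<rho> R"
    and "relative_holonomy M \<rho> D (source P1) (source P2)"
    and "S = canonical_S c v C"
    and "\<And>n. norm n = 1 \<Longrightarrow>
           \<rr> n = (1 / norm (matrix_inv S *v (transpose R *v (S *v n)))) *\<^sub>R
                  (matrix_inv S *v (transpose R *v (S *v n)))"
  shows "\<forall>n \<omega>. norm n = 1 \<longrightarrow>
           directivity P2 n \<omega> =
             ((norm (S *v \<rr> n))\<^sup>2 / (norm (S *v n))\<^sup>2) * directivity P1 (\<rr> n) (\<rho> * \<omega>)"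
proof (intro allI impI)
  fix n :: "real^3" and \<omega> :: real
  assume n: "norm n = 1"
  let ?p = "canonical_p v C"
  \<comment> \<open>The direction \<open>\<rr> n\<close> before normalisation.\<close>
  define y where "y = matrix_inv S *v (transpose R *v (S *v n))"
  have "invertible S"
    using assms(2,4,16) by (simp add: invertible_canonical_S)
  note S = invertible_matrix_inv[OF this]
  have Sy: "S *v y = transpose R *v (S *v n)"
    using S by (simp add: y_def matrix_vector_mul_assoc matrix_mul_assoc)
  have "norm (transpose R *v x) = norm x" for x
    using orthogonal_transformation_transpose[OF \<open>orthogonal_matrix R\<close>]
    by (rule orthogonal_transformation_norm)
  then have norm_Sy: "norm (S *v y) = norm (S *v n)"
    by (simp add: Sy)
  have "S *v n \<noteq> 0"
  proof
    assume "S *v n = 0"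
    then have "matrix_inv S *v (S *v n) = 0" by simp
    with S n show False by (simp add: matrix_vector_mul_assoc)
  qed
  with norm_Sy have "y \<noteq> 0" by auto
  have r: "\<rr> n = (1 / norm y) *\<^sub>R y"
    using assms(17)[OF n] by (simp add: y_def)
  have norm_r: "norm (\<rr> n) = 1"
    using \<open>y \<noteq> 0\<close> by (simp add: r)
  \<comment> \<open>Normalisation removes the positive factor between \<open>\<rr> n\<close> and
    \<open>y\<close>, and \<open>S *v y\<close> has the same norm as \<open>S *v n\<close> because
    \<open>transpose R\<close> is an isometry.\<close>
  have Sr: "(1 / norm (S *v \<rr> n)) *\<^sub>R (S *v \<rr> n) = (1 / norm (S *v n)) *\<^sub>R (transpose R *v (S *v n))"
    using \<open>y \<noteq> 0\<close> by (simp add: r matrix_vector_mult_scaleR norm_Sy) (simp add: Sy)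
  \<comment> \<open>Needed at the end, where the square of this norm cancels the denominator of the
    prefactor of the first directivity.\<close>
  have "S *v \<rr> n \<noteq> 0"
    using norm_Sy \<open>y \<noteq> 0\<close> \<open>S *v n \<noteq> 0\<close> by (auto simp: r matrix_vector_mult_scaleR)
  let ?k = "(\<omega> / (?p * c)) *\<^sub>R ((1 / norm (S *v n)) *\<^sub>R (S *v n))"
  have "directivity P2 n \<omega> = K0 / (norm (S *v n))\<^sup>2 * Re (spectrum M (source P2) (\<omega> / ?p) ?k)"
    using directivity_eq_Re_spectrum[OF assms(10) n assms(16) refl] .
  also have "spectrum M (source P2) (\<omega> / ?p) ?k =
      spectrum M (source P1) (\<rho> * (\<omega> / ?p)) (\<rho> *\<^sub>R (transpose R *v ?k))"
    using assms by (intro spectrum_holonomy) auto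
  \<comment> \<open>With \<open>\<rho>\<close> absorbed into the frequency and the direction
    rewritten by \<open>Sr\<close>, this is the point at which the first pipeline samples in
    direction \<open>\<rr> n\<close> at frequency \<open>\<rho> * \<omega>\<close>.\<close>
  also have "\<dots> = spectrum M (source P1) (\<rho> * \<omega> / ?p)
      ((\<rho> * \<omega> / (?p * c)) *\<^sub>R ((1 / norm (S *v \<rr> n)) *\<^sub>R (S *v \<rr> n)))"
    unfolding Sr by (simp add: matrix_vector_mult_scaleR)
  finally show "directivity P2 n \<omega> =
      ((norm (S *v \<rr> n))\<^sup>2 / (norm (S *v n))\<^sup>2) * directivity P1 (\<rr> n) (\<rho> * \<omega>)"
    using \<open>S *v \<rr> n \<noteq> 0\<close>
    by (simp add: directivity_eq_Re_spectrum[OF assms(9) norm_r assms(16) refl])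
qed

end
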